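(* Let $p,q\in[0,1]$ with $p\neq q$, let $m\ge 1$ be an integer, $T=2m$, and $\lambda=1-p-q$. Consider the two-state discrete time Markov chain on $\{-1,+1\}$ with $T$-periodic transition matrices $P_t$ described in the context (the alternating case), and let $\overline{\nu}(t)=\lim_{N\to\infty}\nu(NT+t)$, $t\in\{0,1,\ldots,T-1\}$, be its invariant measure. Then $$\overline{\nu}(t)=\frac{1}{p+q}\begin{pmatrix} q \\ p \end{pmatrix}-\frac{p-q}{p+q}\cdot\frac{\lambda^{t}}{1+\lambda^{m}}\begin{pmatrix} -1 \\ 1 \end{pmatrix}\qquad\text{for } t\in T_1=\{0,1,\ldots,m-1\},$$ $$\overline{\nu}(t)=\frac{1}{p+q}\begin{pmatrix} p \\ q \end{pmatrix}+\frac{p-q}{p+q}\cdot\frac{\lambda^{t-m}}{1+\lambda^{m}}\begin{pmatrix} -1 \\ 1 \end{pmatrix}\qquad\text{for } t\in T_2=\{m,m+1,\ldots,2m-1\}.$$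
   Context: The chain $Y_t\in\{-1,+1\}$, $t\in\{0,1,2,\ldots\}$, has state probabilities $\nu_-(t)=P(Y_t=-1)$, $\nu_+(t)=P(Y_t=+1)$, $\nu(t)=(\nu_-(t),\nu_+(t))^\dagger$ (with $\dagger$ denoting transpose), so $\nu_-(t)+\nu_+(t)=1$. They evolve by $\nu(t+1)=P_t^\dagger\nu(t)$ from an arbitrary initial probability vector $\nu(0)$. The transition matrices are $T$-periodic: with $n=t \bmod T$, $$P_t=P_1=\begin{pmatrix} 1-p & p \\ q & 1-q \end{pmatrix}\ \text{if } n\in T_1,\qquad P_t=P_2=\begin{pmatrix} 1-q & q \\ p & 1-p \end{pmatrix}\ \text{if } n\in T_2.$$ The invariant measure is $\overline{\nu}(n):=\lim_{N\to\infty}\nu(NT+n)$. *)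

theory Defs
  imports "HOL-Probability.Probability"
begin

(* State -1 is index 1 and state +1 is index 2 of vectors in R^2 and of 2x2 matrices. *)
definition state_index :: "int \<Rightarrow> 2" where
  "state_index y = (if y = -1 then 1 else 2)"

definition P1 :: "real \<Rightarrow> real \<Rightarrow> real^2^2" where
  "P1 p q = vector [vector [1 - p, p], vector [q, 1 - q]]"

definition P2 :: "real \<Rightarrow> real \<Rightarrow> real^2^2" where
  "P2 p q = vector [vector [1 - q, q], vector [p, 1 - p]]"

definition T1 :: "nat \<Rightarrow> nat set" where
  "T1 m = {0..<m}"

definition T2 :: "nat \<Rightarrow> nat set" where
  "T2 m = {m..<2 * m}"

(* T = 2m; for m >= 1 the sets T1 m and T2 m partition the residues {0..<2m}. *)
definition transition_matrix :: "real \<Rightarrow> real \<Rightarrow> nat \<Rightarrow> nat \<Rightarrow> real^2^2" where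
  "transition_matrix p q m t = (if t mod (2 * m) \<in> T1 m then P1 p q else P2 p q)"

(* Markov property with one-step transition matrices P t, required for every history of
   positive probability; the law of Y 0 is unconstrained. *)
definition two_state_markov_chain ::
  "'a measure \<Rightarrow> (nat \<Rightarrow> real^2^2) \<Rightarrow> (nat \<Rightarrow> 'a \<Rightarrow> int) \<Rightarrow> bool" where
  "two_state_markov_chain M P Y \<longleftrightarrow>
     prob_space M \<and>
     (\<forall>t. Y t \<in> measurable M (count_space {-1, 1})) \<and>
     (\<forall>t x. \<forall>y\<in>{-1, 1}.
        \<P>(\<omega> in M. \<forall>s\<le>t. Y s \<omega> = x s) > 0 \<longrightarrow>
        \<P>(\<omega> in M. Y (Suc t) \<omega> = y \<bar> \<forall>s\<le>t. Y s \<omega> = x s)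
          = P t $ state_index (x t) $ state_index y)"

definition state_probs :: "'a measure \<Rightarrow> (nat \<Rightarrow> 'a \<Rightarrow> int) \<Rightarrow> nat \<Rightarrow> real^2" where
  "state_probs M Y t = vector [\<P>(\<omega> in M. Y t \<omega> = -1), \<P>(\<omega> in M. Y t \<omega> = 1)]"

definition invariant_measure :: "(nat \<Rightarrow> real^2) \<Rightarrow> nat \<Rightarrow> nat \<Rightarrow> real^2" where
  "invariant_measure \<nu> T n = lim (\<lambda>N. \<nu> (N * T + n))"

lemma state_probs_Suc:
  assumes "two_state_markov_chain M P Y"
  shows "state_probs M Y (Suc t) = transpose (P t) *v state_probs M Y t"
proof -
  interpret prob_space M using assms by (simp add: two_state_markov_chain_def)
  have Y[measurable]: "Y t \<in> measurable M (count_space {-1, 1})" for t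
    using assms by (simp add: two_state_markov_chain_def)
  have Yv: "Y t \<omega> \<in> {-1, 1}" if "\<omega> \<in> space M" for t \<omega>
    using measurable_space[OF Y that] by simp
  have [measurable]: "Measurable.pred M (\<lambda>\<omega>. Y s \<omega> = c)" for s c
  proof -
    have "(\<lambda>y. y = c) \<in> measurable (count_space {-1, 1}) (count_space UNIV)" by simp
    from measurable_compose[OF Y this] show ?thesis by simp
  qed
  define X where "X = PiE {..t} (\<lambda>_. {-1, 1 :: int})"
  define H where "H x = (\<lambda>\<omega>. \<forall>s\<le>t. Y s \<omega> = x s)" for x
  have Hm[measurable]: "Measurable.pred M (H x)" for x
    unfolding H_def by measurable
  have finX: "finite X" unfolding X_def by (intro finite_PiE) auto
  have uniq: "\<exists>!x. x \<in> X \<and> H x \<omega>" if "\<omega> \<in> space M" for \<omega>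
  proof (rule ex1I[of _ "restrict (\<lambda>s. Y s \<omega>) {..t}"])
    show "restrict (\<lambda>s. Y s \<omega>) {..t} \<in> X \<and> H (restrict (\<lambda>s. Y s \<omega>) {..t}) \<omega>"
      using Yv[OF that] unfolding X_def H_def by (auto simp: PiE_iff)
    show "x = restrict (\<lambda>s. Y s \<omega>) {..t}" if "x \<in> X \<and> H x \<omega>" for x
      using that unfolding X_def H_def by (auto simp: fun_eq_iff PiE_iff extensional_def)
  qed
  have dec: "\<P>(\<omega> in M. A \<omega>) = (\<Sum>x\<in>X. \<P>(\<omega> in M. A \<omega> \<and> H x \<omega>))"
    if [measurable]: "Measurable.pred M A" for A
  proof (rule prob_sum[OF finX])
    show "{\<omega> \<in> space M. A \<omega>} \<in> events" by measurable
    show "{\<omega> \<in> space M. A \<omega> \<and> H x \<omega>} \<in> events" for x by measurable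
    show "AE \<omega> in M. (\<forall>n\<in>X. A \<omega> \<and> H n \<omega> \<longrightarrow> A \<omega>) \<and> (A \<omega> \<longrightarrow> (\<exists>!n. n \<in> X \<and> A \<omega> \<and> H n \<omega>))"
      using uniq by (intro AE_I2) auto
  qed
  have step: "\<P>(\<omega> in M. Y (Suc t) \<omega> = y \<and> H x \<omega>)
      = \<P>(\<omega> in M. H x \<omega>) * P t $ state_index (x t) $ state_index y"
    if "y \<in> {-1, 1}" for x y
  proof (cases "\<P>(\<omega> in M. H x \<omega>) > 0")
    case True
    then have "\<P>(\<omega> in M. Y (Suc t) \<omega> = y \<bar> H x \<omega>) = P t $ state_index (x t) $ state_index y"
      using assms that unfolding two_state_markov_chain_def H_def by blast
    with True show ?thesis by (auto simp: cond_prob_def field_simps)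
  next
    case False
    then have "\<P>(\<omega> in M. H x \<omega>) = 0" by (simp add: order.antisym not_less)
    moreover have "\<P>(\<omega> in M. Y (Suc t) \<omega> = y \<and> H x \<omega>) \<le> \<P>(\<omega> in M. H x \<omega>)"
      by (intro finite_measure_mono) auto
    ultimately show ?thesis by (simp add: order.antisym)
  qed
  have now: "\<P>(\<omega> in M. Y t \<omega> = i) = (\<Sum>x\<in>X. if x t = i then \<P>(\<omega> in M. H x \<omega>) else 0)" for i
  proof -
    have "\<P>(\<omega> in M. Y t \<omega> = i \<and> H x \<omega>) = (if x t = i then \<P>(\<omega> in M. H x \<omega>) else 0)" for x
    proof (cases "x t = i")
      case True
      then have "(Y t \<omega> = i \<and> H x \<omega>) = H x \<omega>" for \<omega> by (auto simp: H_def)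
      with True show ?thesis by simp
    next
      case False
      then have "\<not> (Y t \<omega> = i \<and> H x \<omega>)" for \<omega> by (auto simp: H_def)
      then have "{\<omega> \<in> space M. Y t \<omega> = i \<and> H x \<omega>} = {}" by blast
      then show ?thesis using False by (simp only: measure_empty if_False)
    qed
    then show ?thesis by (subst dec) auto
  qed
  have next_prob: "\<P>(\<omega> in M. Y (Suc t) \<omega> = y) =
     P t $ 1 $ state_index y * \<P>(\<omega> in M. Y t \<omega> = -1) + P t $ 2 $ state_index y * \<P>(\<omega> in M. Y t \<omega> = 1)"
    if y: "y \<in> {-1, 1}" for y
  proof -
    have "\<P>(\<omega> in M. Y (Suc t) \<omega> = y) =
        (\<Sum>x\<in>X. \<P>(\<omega> in M. H x \<omega>) * P t $ state_index (x t) $ state_index y)"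
      by (subst dec) (auto simp: step[OF y])
    also have "\<dots> = (\<Sum>x\<in>X. P t $ 1 $ state_index y * (if x t = -1 then \<P>(\<omega> in M. H x \<omega>) else 0)
        + P t $ 2 $ state_index y * (if x t = 1 then \<P>(\<omega> in M. H x \<omega>) else 0))"
    proof (rule sum.cong[OF refl])
      fix x assume "x \<in> X"
      then have "x t \<in> {-1, 1}" by (auto simp: X_def PiE_iff)
      then show "\<P>(\<omega> in M. H x \<omega>) * P t $ state_index (x t) $ state_index y =
          P t $ 1 $ state_index y * (if x t = -1 then \<P>(\<omega> in M. H x \<omega>) else 0)
        + P t $ 2 $ state_index y * (if x t = 1 then \<P>(\<omega> in M. H x \<omega>) else 0)"
        by (auto simp: state_index_def)
    qed
    finally show ?thesis by (simp add: sum.distrib now sum_distrib_left)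
  qed
  show ?thesis
    by (simp add: vec_eq_iff forall_2 state_probs_def matrix_vector_mult_def transpose_def
        sum_2 next_prob) (simp add: state_index_def)
qed

end

theory Submission
  imports Defs
begin

text \<open>
  Both transition matrices have row sums 1 and eigenvalues 1 and \<^term>\<open>1 - p - q\<close>, and the
  eigenvector of the transposed matrices for the second eigenvalue is in both cases the vector of
  total mass zero. Hence the difference of two solutions of the evolution equation with equal mass
  is multiplied by \<open>\<lambda> = 1 - p - q\<close> at every step, whichever matrix is in force
  (\<open>transition_contracts\<close>). Since \<open>\<bar>\<lambda>\<bar> < 1\<close>, all solutions of mass one approach each other
  geometrically, and it is enough to exhibit one that is \<open>2 m\<close>-periodic.

  Such a solution relaxes with factor \<open>\<lambda>\<close> towards \<open>(q, p) / (p + q)\<close>, the stationary vector of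
  \<^const>\<open>P1\<close>, during the first half period and towards \<open>(p, q) / (p + q)\<close>, the stationary vector of
  \<^const>\<open>P2\<close>, during the second. Exchanging the states exchanges the two matrices, so the two halves should be
  mirror images. If \<open>c\<close> is the initial deviation in a half period, continuity at the switch reads
  \<open>c (1 + \<lambda> ^ m) = (p - q) / (p + q)\<close>, up to sign: this is where the denominator \<open>1 + \<lambda> ^ m\<close>
  comes from. That the resulting formula does solve the evolution equation is
  \<open>periodic_solution_Suc\<close>.
\<close>

definition relaxation :: "real \<Rightarrow> real \<Rightarrow> nat \<Rightarrow> nat \<Rightarrow> real^2" where
  "relaxation p q m k =
     (1 / (p + q)) *\<^sub>R vector [q, p]
     - ((p - q) / (p + q) * ((1 - p - q) ^ k / (1 + (1 - p - q) ^ m))) *\<^sub>R vector [-1, 1]"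

text \<open>In the second half period the roles of \<^term>\<open>p\<close> and \<^term>\<open>q\<close> are exchanged, which leaves
  \<^term>\<open>1 - p - q\<close> unchanged.\<close>

definition periodic_solution :: "real \<Rightarrow> real \<Rightarrow> nat \<Rightarrow> nat \<Rightarrow> real^2" where
  "periodic_solution p q m t =
     (let n = t mod (2 * m) in if n < m then relaxation p q m n else relaxation q p m (n - m))"

lemma P2_eq_P1_swap: "P2 p q = P1 q p"
  by (simp add: P1_def P2_def)

lemma transition_matrix_eq:
  "transition_matrix p q m t = (if t mod (2 * m) < m then P1 p q else P1 q p)"
  by (simp add: transition_matrix_def T1_def P2_eq_P1_swap)

lemma transpose_P1_mult:
  "transpose (P1 p q) *v v = vector [(1 - p) * v $ 1 + q * v $ 2, p * v $ 1 + (1 - q) * v $ 2]"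
  by (simp add: vec_eq_iff forall_2 P1_def matrix_vector_mult_def transpose_def sum_2)

lemma P1_contracts:
  assumes "u $ 1 + u $ 2 = w $ 1 + w $ 2"
  shows "transpose (P1 p q) *v u - transpose (P1 p q) *v w = (1 - p - q) *\<^sub>R (u - w)"
proof -
  have u2: "u $ 2 = w $ 1 + w $ 2 - u $ 1" using assms by simp
  show ?thesis
    unfolding transpose_P1_mult by (simp add: vec_eq_iff forall_2 u2 algebra_simps)
qed

lemma transition_contracts:
  assumes "u $ 1 + u $ 2 = w $ 1 + w $ 2"
  shows "transpose (transition_matrix p q m t) *v u - transpose (transition_matrix p q m t) *v w
       = (1 - p - q) *\<^sub>R (u - w)"
  using P1_contracts[OF assms, of p q] P1_contracts[OF assms, of q p]
  by (simp add: transition_matrix_eq algebra_simps)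

lemma relaxation_Suc: "relaxation p q m (Suc k) = transpose (P1 p q) *v relaxation p q m k"
proof -
  define a where "a = 1 / (p + q)"
  define c where "c = (p - q) / (p + q) * ((1 - p - q) ^ k / (1 + (1 - p - q) ^ m))"
  have k: "relaxation p q m k = a *\<^sub>R vector [q, p] - c *\<^sub>R vector [-1, 1]"
    by (simp add: relaxation_def a_def c_def)
  have Suc: "relaxation p q m (Suc k)
      = a *\<^sub>R vector [q, p] - ((1 - p - q) * c) *\<^sub>R vector [-1, 1]"
    by (simp add: relaxation_def a_def c_def)
  show ?thesis
    unfolding k Suc transpose_P1_mult by (simp add: vec_eq_iff forall_2 algebra_simps)
qed

text \<open>The defining property of the amplitude: a half period ends where its mirror image starts.\<close>

lemma relaxation_switch:
  assumes "p + q \<noteq> 0" "1 + (1 - p - q) ^ m \<noteq> 0"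
  shows "relaxation p q m m = relaxation q p m 0"
proof -
  define d where "d = (1 - p - q) ^ m"
  have d: "(1 - q - p) ^ m = d" by (simp add: d_def algebra_simps)
  show ?thesis
    using assms
    by (simp add: relaxation_def d flip: d_def)
      (simp add: vec_eq_iff forall_2 add.commute[of q p] divide_simps, simp add: algebra_simps)
qed

lemma relaxation_mass:
  assumes "p + q \<noteq> 0"
  shows "relaxation p q m k $ 1 + relaxation p q m k $ 2 = 1"
  using assms by (simp add: relaxation_def add_divide_distrib[symmetric])

lemma periodic_solution_mass:
  assumes "p + q \<noteq> 0"
  shows "periodic_solution p q m t $ 1 + periodic_solution p q m t $ 2 = 1"
  using relaxation_mass[of p q] relaxation_mass[of q p] assms
  by (simp add: periodic_solution_def Let_def add.commute)

lemma periodic_solution_periodic: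
  "periodic_solution p q m (N * (2 * m) + t) = periodic_solution p q m t"
  by (simp add: periodic_solution_def)

lemma periodic_solution_Suc:
  assumes m: "m \<ge> 1" and pq: "p + q \<noteq> 0" and nz: "1 + (1 - p - q) ^ m \<noteq> 0"
  shows "periodic_solution p q m (Suc t)
       = transpose (transition_matrix p q m t) *v periodic_solution p q m t"
proof -
  define n where "n = t mod (2 * m)"
  have n: "n < 2 * m" using m by (simp add: n_def)
  have next_residue: "Suc t mod (2 * m) = (if Suc n = 2 * m then 0 else Suc n)"
    by (simp add: mod_Suc n_def)
  have qp: "q + p \<noteq> 0" "1 + (1 - q - p) ^ m \<noteq> 0"
    using pq nz by (simp_all add: algebra_simps)
  note switch = relaxation_switch[OF pq nz] relaxation_switch[OF qp]
  consider "Suc n < m" | "Suc n = m" | "m \<le> n" "Suc n < 2 * m" | "Suc n = 2 * m"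
    using n by linarith
  then show ?thesis
  proof cases
    case 1
    then show ?thesis using m relaxation_Suc[of p q m n]
      by (simp add: periodic_solution_def transition_matrix_eq next_residue flip: n_def)
  next
    case 2
    then show ?thesis using m relaxation_Suc[of p q m n] switch
      by (simp add: periodic_solution_def transition_matrix_eq next_residue flip: n_def)
  next
    case 3
    then show ?thesis using m relaxation_Suc[of q p m "n - m"]
      by (simp add: periodic_solution_def transition_matrix_eq next_residue Suc_diff_le flip: n_def)
  next
    case 4
    then have "n \<ge> m" "Suc (n - m) = m" using m by auto
    then show ?thesis using 4 m relaxation_Suc[of q p m "n - m"] switch
      by (simp add: periodic_solution_def transition_matrix_eq next_residue flip: n_def)
  qed
qed

lemma state_probs_mass:
  assumes "two_state_markov_chain M P Y"
  shows "state_probs M Y t $ 1 + state_probs M Y t $ 2 = 1"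
proof -
  interpret prob_space M using assms by (simp add: two_state_markov_chain_def)
  have Y: "Y t \<in> measurable M (count_space {-1, 1})"
    using assms by (simp add: two_state_markov_chain_def)
  have ev: "{\<omega> \<in> space M. Y t \<omega> = 1} \<in> events"
    using measurable_sets[OF Y, of "{1}"] by (simp add: vimage_def Int_def conj_commute)
  have "\<P>(\<omega> in M. \<not> Y t \<omega> = 1) = 1 - \<P>(\<omega> in M. Y t \<omega> = 1)"
    by (rule prob_neg[OF ev])
  moreover have "{\<omega> \<in> space M. \<not> Y t \<omega> = 1} = {\<omega> \<in> space M. Y t \<omega> = -1}"
    using measurable_space[OF Y] by fastforce
  ultimately show ?thesis by (simp add: state_probs_def)
qed

lemma state_probs_minus_periodic_solution:
  assumes m: "m \<ge> 1" and pq: "p + q \<noteq> 0" and nz: "1 + (1 - p - q) ^ m \<noteq> 0"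
    and Y: "two_state_markov_chain M (transition_matrix p q m) Y"
  shows "state_probs M Y t - periodic_solution p q m t
       = (1 - p - q) ^ t *\<^sub>R (state_probs M Y 0 - periodic_solution p q m 0)"
proof (induction t)
  case (Suc t)
  have "state_probs M Y (Suc t) - periodic_solution p q m (Suc t)
      = (1 - p - q) *\<^sub>R (state_probs M Y t - periodic_solution p q m t)"
    unfolding state_probs_Suc[OF Y] periodic_solution_Suc[OF m pq nz]
    by (rule transition_contracts)
      (simp add: state_probs_mass[OF Y] periodic_solution_mass[OF pq])
  then show ?case by (simp add: Suc.IH)
qed simp

lemma state_probs_tendsto_periodic_solution:
  assumes m: "m \<ge> 1" and pq: "p + q \<noteq> 0" and lam: "\<bar>1 - p - q\<bar> < 1"
    and Y: "two_state_markov_chain M (transition_matrix p q m) Y"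
  shows "(\<lambda>N. state_probs M Y (N * (2 * m) + t)) \<longlonglongrightarrow> periodic_solution p q m t"
proof -
  have "\<bar>(1 - p - q) ^ m\<bar> < 1"
    unfolding power_abs using lam m by (simp add: power_less_one_iff)
  then have nz: "1 + (1 - p - q) ^ m \<noteq> 0" by linarith
  define d where "d = state_probs M Y 0 - periodic_solution p q m 0"
  have "filterlim (\<lambda>N. N * (2 * m) + t) at_top sequentially"
    using m by (intro filterlim_subseq) (auto simp: strict_mono_def)
  then have "(\<lambda>N. (1 - p - q) ^ (N * (2 * m) + t)) \<longlonglongrightarrow> 0"
    using lam by (intro filterlim_compose[OF LIMSEQ_power_zero]) auto
  then have "(\<lambda>N. periodic_solution p q m t + (1 - p - q) ^ (N * (2 * m) + t) *\<^sub>R d)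
      \<longlonglongrightarrow> periodic_solution p q m t + 0 *\<^sub>R d"
    by (intro tendsto_intros)
  moreover have "state_probs M Y (N * (2 * m) + t)
      = periodic_solution p q m t + (1 - p - q) ^ (N * (2 * m) + t) *\<^sub>R d" for N
    using state_probs_minus_periodic_solution[OF m pq nz Y, of "N * (2 * m) + t"]
    unfolding periodic_solution_periodic d_def[symmetric] by (simp add: algebra_simps)
  ultimately show ?thesis by simp
qed

theorem corollary3p3:
  fixes p q lam :: real and m T :: nat
    and M :: "'a measure" and Y :: "nat \<Rightarrow> 'a \<Rightarrow> int" and \<nu> :: "nat \<Rightarrow> real^2"
  assumes "p \<in> {0..1}" and "q \<in> {0..1}" and "p \<noteq> q"
    and "m \<ge> 1" and "T = 2 * m" and "lam = 1 - p - q"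
    and "two_state_markov_chain M (transition_matrix p q m) Y"
    and "\<nu> = state_probs M Y"
  shows "(\<forall>t\<in>{0..<T}. convergent (\<lambda>N. \<nu> (N * T + t))) \<and>
    (\<forall>t\<in>T1 m. invariant_measure \<nu> T t =
           (1 / (p + q)) *\<^sub>R vector [q, p]
           - ((p - q) / (p + q) * (lam ^ t / (1 + lam ^ m))) *\<^sub>R vector [-1, 1]) \<and>
    (\<forall>t\<in>T2 m. invariant_measure \<nu> T t =
           (1 / (p + q)) *\<^sub>R vector [p, q]
           + ((p - q) / (p + q) * (lam ^ (t - m) / (1 + lam ^ m))) *\<^sub>R vector [-1, 1])"
proof -
  \<comment> \<open>As \<^term>\<open>p \<noteq> q\<close>, the corners \<open>p = q = 0\<close> and \<open>p = q = 1\<close>, where \<open>\<bar>\<lambda>\<bar> = 1\<close>, are excluded.\<close>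
  have pq: "p + q \<noteq> 0" and lam: "\<bar>1 - p - q\<bar> < 1"
    using assms(1-3) by auto
  have lim: "(\<lambda>N. \<nu> (N * T + t)) \<longlonglongrightarrow> periodic_solution p q m t" for t
    using state_probs_tendsto_periodic_solution[OF assms(4) pq lam assms(7)]
    by (simp add: assms(5,8))
  have inv: "invariant_measure \<nu> T t = periodic_solution p q m t" for t
    unfolding invariant_measure_def by (rule limI[OF lim])
  have sol1: "periodic_solution p q m t = relaxation p q m t" if "t \<in> T1 m" for t
    using that by (simp add: periodic_solution_def T1_def)
  have sol2: "periodic_solution p q m t = relaxation q p m (t - m)" if "t \<in> T2 m" for t
    using that by (simp add: periodic_solution_def T2_def)
  have swap: "1 - q - p = lam" "q + p = p + q" "(q - p) / (p + q) = - ((p - q) / (p + q))"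
    using assms(6) by (simp_all add: minus_divide_left)
  show ?thesis
  proof (intro conjI ballI)
    show "convergent (\<lambda>N. \<nu> (N * T + t))" for t
      using lim by (rule convergentI)
    show "invariant_measure \<nu> T t = (1 / (p + q)) *\<^sub>R vector [q, p]
        - ((p - q) / (p + q) * (lam ^ t / (1 + lam ^ m))) *\<^sub>R vector [-1, 1]" if "t \<in> T1 m" for t
      unfolding inv sol1[OF that] relaxation_def assms(6) ..
    show "invariant_measure \<nu> T t = (1 / (p + q)) *\<^sub>R vector [p, q]
        + ((p - q) / (p + q) * (lam ^ (t - m) / (1 + lam ^ m))) *\<^sub>R vector [-1, 1]"
      if "t \<in> T2 m" for t
      unfolding inv sol2[OF that] relaxation_def swap by simp
  qed
qed

end
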